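(* Let $K$ be a CM-field of degree $4$ over $\mathbf{Q}$ and let $p$ be a prime number that factors in $K$ as $p\mathcal{O}_K=\mathfrak{p}_1\overline{\mathfrak{p}_1}\mathfrak{p}_2$ with $\mathfrak{p}_1,\overline{\mathfrak{p}_1},\mathfrak{p}_2$ pairwise distinct prime ideals. Suppose that $\mathfrak{p}_1=\alpha\mathcal{O}_K$ is principal. Then $\pi=\alpha\overline{\alpha}^{-1}p$ is a Weil $p^2$-number satisfying the following: the field $\mathbf{Q}(\pi)$ equals $K$ (so it is a CM-field of degree $4$), $p\mathcal{O}_K=\mathfrak{p}_1\overline{\mathfrak{p}_1}\mathfrak{p}_2$, and $\pi\mathcal{O}_K=\mathfrak{p}_1^2\mathfrak{p}_2$.
   Context: A CM-field is a totally imaginary quadratic extension of a totally real number field; the bar denotes its complex conjugation, acting on elements and on ideals. $\mathcal{O}_K$ is the ring of integers of $K$. A Weil $q$-number is an algebraic integer $\pi$ such that $|\pi|^2=q$ for every embedding of $\mathbf{Q}(\pi)$ into $\mathbf{C}$. *)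

theory Defs
  imports Complex_Main "HOL-Algebra.Algebra" "HOL-Algebra.Algebraic_Closure_Type"
begin

abbreviation complex_ring :: "complex ring"
  where "complex_ring \<equiv> ring_of_type_algebra"

text \<open>An abstract field is a record as in \<open>HOL-Algebra\<close>; a subfield with underlying set \<open>F\<close>
  is the record \<open>K\<lparr>carrier := F\<rparr>\<close>. In characteristic zero, \<open>generate_field K H\<close> is the field
  obtained by adjoining \<open>H\<close> to the rational numbers, so \<open>generate_field K {}\<close> is the copy of the
  rationals in \<open>K\<close>.\<close>

definition has_degree :: "('a, 'b) ring_scheme \<Rightarrow> nat \<Rightarrow> bool"
  where "has_degree K n \<longleftrightarrow> ring.dimension K n (generate_field K {}) (carrier K)"

definition number_field :: "('a, 'b) ring_scheme \<Rightarrow> bool"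
  where "number_field K \<longleftrightarrow>
    field K \<and> (\<forall>n::nat. n > 0 \<longrightarrow> [n] \<cdot>\<^bsub>K\<^esub> \<one>\<^bsub>K\<^esub> \<noteq> \<zero>\<^bsub>K\<^esub>) \<and> (\<exists>n. has_degree K n)"

definition embeddings :: "('a, 'b) ring_scheme \<Rightarrow> ('a \<Rightarrow> complex) set"
  where "embeddings K = ring_hom K complex_ring"

definition totally_real :: "('a, 'b) ring_scheme \<Rightarrow> bool"
  where "totally_real K \<longleftrightarrow> (\<forall>\<sigma>\<in>embeddings K. \<sigma> ` carrier K \<subseteq> \<real>)"

definition totally_imaginary :: "('a, 'b) ring_scheme \<Rightarrow> bool"
  where "totally_imaginary K \<longleftrightarrow> (\<forall>\<sigma>\<in>embeddings K. \<not> \<sigma> ` carrier K \<subseteq> \<real>)"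

definition cm_field :: "('a, 'b) ring_scheme \<Rightarrow> bool"
  where "cm_field K \<longleftrightarrow> number_field K \<and> totally_imaginary K \<and>
    (\<exists>F. subfield F K \<and> number_field (K\<lparr>carrier := F\<rparr>) \<and> totally_real (K\<lparr>carrier := F\<rparr>) \<and>
         ring.dimension K 2 F (carrier K))"

text \<open>The complex conjugation of a CM-field is the map that every complex embedding turns into
  the conjugation of the complex numbers. The value is unique because embeddings exist and are
  injective; it exists for all \<open>x\<close> in \<open>K\<close> when \<open>K\<close> is a CM-field.\<close>

definition cm_conj :: "('a, 'b) ring_scheme \<Rightarrow> 'a \<Rightarrow> 'a"
  where "cm_conj K x = (THE y. y \<in> carrier K \<and> (\<forall>\<sigma>\<in>embeddings K. \<sigma> y = cnj (\<sigma> x)))"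

text \<open>Polynomials are coefficient lists with the leading coefficient first.\<close>

definition alg_integer :: "('a, 'b) ring_scheme \<Rightarrow> 'a \<Rightarrow> bool"
  where "alg_integer K x \<longleftrightarrow> x \<in> carrier K \<and>
    (\<exists>f \<in> carrier (univ_poly K (range (\<lambda>k::int. [k] \<cdot>\<^bsub>K\<^esub> \<one>\<^bsub>K\<^esub>))).
       f \<noteq> [] \<and> hd f = \<one>\<^bsub>K\<^esub> \<and> ring.eval K f x = \<zero>\<^bsub>K\<^esub>)"

definition ring_of_integers :: "('a, 'b) ring_scheme \<Rightarrow> ('a, 'b) ring_scheme"  (\<open>\<O>\<close>)
  where "\<O> K = K\<lparr>carrier := {x \<in> carrier K. alg_integer K x}\<rparr>"

abbreviation adjoin :: "('a, 'b) ring_scheme \<Rightarrow> 'a \<Rightarrow> ('a, 'b) ring_scheme"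
  where "adjoin K x \<equiv> K\<lparr>carrier := generate_field K {x}\<rparr>"

definition weil_number :: "('a, 'b) ring_scheme \<Rightarrow> nat \<Rightarrow> 'a \<Rightarrow> bool"
  where "weil_number K q \<pi> \<longleftrightarrow> alg_integer K \<pi> \<and>
    (\<forall>\<sigma>\<in>embeddings (adjoin K \<pi>). (cmod (\<sigma> \<pi>))\<^sup>2 = real q)"

end

theory Submission
  imports Defs
begin

text \<open>Cancelling \<open>\<alpha>\<close> and its conjugate \<open>\<alpha>'\<close> in the factorization of \<open>p\<close> shows that \<open>P2\<close> is
  principal, generated by \<open>\<beta>\<close> with \<open>p = \<alpha> \<alpha>' \<beta>\<close>, so that \<open>\<pi> = \<alpha>\<^sup>2 \<beta>\<close>. If \<open>u \<pi>\<^sup>2 + v \<pi> + w = 0\<close> with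
  integers \<open>u, v, w\<close>, then successive divisions by \<open>\<beta>\<close>, \<open>\<alpha>\<close>, \<open>\<beta>\<close>, \<open>\<alpha>'\<close> show that \<open>p\<close> divides all
  three, and infinite descent makes them zero: the valuations of \<open>\<pi>\<close> at the three primes are
  \<open>2, 0, 1\<close>, and three distinct values rule out a quadratic relation. Hence \<open>\<pi>\<close> generates a
  subfield of degree more than \<open>2\<close>, which is all of \<open>K\<close>.\<close>

section \<open>Infinite descent on integral quadratic relations\<close>

lemma integral_quadratic_relation_trivial:
  fixes S :: "'a :: {idom, ring_char_0} set" and a a' b :: 'a and p :: nat and u v w :: int
  defines "D \<equiv> \<lambda>x y. \<exists>z\<in>S. y = z * x"
  assumes p: "Factorial_Ring.prime p" and pab: "of_nat p = a * a' * b"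
    and S: "\<And>x y. x \<in> S \<Longrightarrow> y \<in> S \<Longrightarrow> x + y \<in> S" "\<And>x y. x \<in> S \<Longrightarrow> y \<in> S \<Longrightarrow> x * y \<in> S"
      "\<And>k. of_int k \<in> S"
    and mem: "a \<in> S" "a' \<in> S" "b \<in> S"
    and prime: "\<And>x y. x \<in> S \<Longrightarrow> y \<in> S \<Longrightarrow> D a (x * y) \<Longrightarrow> D a x \<or> D a y"
      "\<And>x y. x \<in> S \<Longrightarrow> y \<in> S \<Longrightarrow> D a' (x * y) \<Longrightarrow> D a' x \<or> D a' y"
    and ndvd: "\<not> D a a'" "\<not> D a' a" and nunit: "\<not> D a 1" "\<not> D a' 1" "\<not> D b 1"
    and eq: "of_int u * (a\<^sup>2 * b)\<^sup>2 + of_int v * (a\<^sup>2 * b) + of_int w = 0"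
  shows "u = 0 \<and> v = 0 \<and> w = 0"
  using eq
proof (induction "nat (\<bar>u\<bar> + \<bar>v\<bar> + \<bar>w\<bar>)" arbitrary: u v w rule: less_induct)
  case less
  have p0: "(of_nat p :: 'a) \<noteq> 0"
    using p by (auto simp: prime_gt_0_nat)
  then have nz: "a \<noteq> 0" "a' \<noteq> 0" "b \<noteq> 0"
    using pab by auto
  have neg: "- x \<in> S" if "x \<in> S" for x
    using S(2)[OF S(3)[of "-1"] that] by simp
  \<comment> \<open>A nonunit divisor \<open>x\<close> of \<open>p\<close> can divide an integer
    \<open>k\<close> only if \<open>p\<close> does: otherwise Bezout writes 1 as a combination of
    \<open>p\<close> and \<open>k\<close>, both multiples of \<open>x\<close>. Each step of the
    descent uses this to pass from \<open>a\<close>, \<open>a'\<close> or \<open>b\<close> to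
    \<open>p\<close>.\<close>
  have pdvd: "int p dvd k" if "D x (of_int k)" "\<not> D x 1" "D x (of_nat p)" for x and k :: int
  proof (rule ccontr)
    assume "\<not> int p dvd k"
    then have "coprime (int p) k"
      using p by (simp add: prime_imp_coprime)
    then obtain s t where st: "s * int p + t * k = 1"
      using bezout_int[of "int p" k] by auto
    from that obtain y z where yz: "y \<in> S" "of_int k = y * x" "z \<in> S" "of_nat p = z * x"
      by (auto simp: D_def)
    have "1 = of_int (s * int p + t * k)"
      using st by simp
    also have "\<dots> = (of_int s * z + of_int t * y) * x"
      using yz by (simp add: algebra_simps)
    finally show False
      using that(2) yz S unfolding D_def by metis
  qed
  have Dp: "D a (of_nat p)" "D a' (of_nat p)" "D b (of_nat p)"
  proof -
    have "of_nat p = (a' * b) * a" "of_nat p = (a * b) * a'" "of_nat p = (a * a') * b"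
      by (simp_all add: pab mult_ac)
    then show "D a (of_nat p)" "D a' (of_nat p)" "D b (of_nat p)"
      unfolding D_def using S(2) mem by metis+
  qed
  have "of_int w = - (of_int u * (a * a * a * a * b) + of_int v * (a * a)) * b"
    using less.prems by (simp add: algebra_simps power2_eq_square eq_neg_iff_add_eq_0)
  then have "D b (of_int w)"
    unfolding D_def using S mem neg by metis
  then obtain w1 where w1: "w = int p * w1"
    using pdvd[OF _ nunit(3) Dp(3)] by blast
  \<comment> \<open>With \<open>w = p * w1\<close> and \<open>p = a * a' * b\<close>, every term of
    the relation contains \<open>a * b\<close>, which cancels.\<close>
  have "(a * b) * (of_int u * (a * a * a * b) + of_int v * a + a' * of_int w1) = 0"
    using less.prems by (simp add: w1 pab algebra_simps power2_eq_square)
  then have eq1: "of_int u * (a * a * a * b) + of_int v * a + a' * of_int w1 = 0"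
    using nz by simp
  \<comment> \<open>Modulo \<open>a\<close> only the last term survives; \<open>a\<close> is prime
    and does not divide \<open>a'\<close>, so it divides \<open>w1\<close>. Thus \<open>w\<close> is
    divisible by the square of \<open>p\<close>, and the surplus factor is what lets the next
    divisions go through.\<close>
  then have "a' * of_int w1 = - (of_int u * (a * a * b) + of_int v) * a"
    by (simp add: algebra_simps eq_neg_iff_add_eq_0)
  then have "D a (a' * of_int w1)"
    unfolding D_def using S mem neg by metis
  then have "D a (of_int w1)"
    using prime(1) ndvd(1) mem S(3) by blast
  then obtain w2 where w2: "w1 = int p * w2"
    using pdvd[OF _ nunit(1) Dp(1)] by blast
  have "a * (of_int u * (a * a * b) + of_int v + a' * a' * b * of_int w2) = 0"
    using eq1 by (simp add: w2 pab algebra_simps)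
  then have eq2: "of_int u * (a * a * b) + of_int v + a' * a' * b * of_int w2 = 0"
    using nz by simp
  then have "of_int v = - (of_int u * (a * a) + a' * a' * of_int w2) * b"
    by (simp add: algebra_simps eq_neg_iff_add_eq_0)
  then have "D b (of_int v)"
    unfolding D_def using S mem neg by metis
  then obtain v1 where v1: "v = int p * v1"
    using pdvd[OF _ nunit(3) Dp(3)] by blast
  have "b * (of_int u * (a * a) + a * a' * of_int v1 + a' * a' * of_int w2) = 0"
    using eq2 by (simp add: v1 pab algebra_simps)
  then have "of_int u * (a * a) + a * a' * of_int v1 + a' * a' * of_int w2 = 0"
    using nz by simp
  \<comment> \<open>Now \<open>a'\<close> divides both terms other than the first. Being prime and
    not a divisor of \<open>a\<close>, it must divide \<open>u\<close>.\<close>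
  then have "of_int u * (a * a) = - (a * of_int v1 + a' * of_int w2) * a'"
    by (simp add: algebra_simps eq_neg_iff_add_eq_0)
  then have "D a' (of_int u * (a * a))"
    unfolding D_def using S mem neg by metis
  then have "D a' (of_int u)"
    using prime(2) ndvd(2) mem S(2,3) by metis
  then obtain u1 where u1: "u = int p * u1"
    using pdvd[OF _ nunit(2) Dp(2)] by blast
  have "of_nat p * (of_int u1 * (a\<^sup>2 * b)\<^sup>2 + of_int v1 * (a\<^sup>2 * b) + of_int w1) = 0"
    using less.prems by (simp add: u1 v1 w1 algebra_simps)
  then have eq': "of_int u1 * (a\<^sup>2 * b)\<^sup>2 + of_int v1 * (a\<^sup>2 * b) + of_int w1 = 0"
    using p0 by simp
  show ?case
  proof (rule ccontr)
    assume nontriv: "\<not> ?thesis"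
    \<comment> \<open>The original measure is \<open>p * n\<close>, which exceeds \<open>n\<close>
      as soon as \<open>n\<close> is positive, so the induction hypothesis applies to the quotients
      \<open>u1\<close>, \<open>v1\<close>, \<open>w1\<close>.\<close>
    define n where "n = \<bar>u1\<bar> + \<bar>v1\<bar> + \<bar>w1\<bar>"
    have n: "\<bar>u\<bar> + \<bar>v\<bar> + \<bar>w\<bar> = int p * n"
      by (simp add: n_def u1 v1 w1 abs_mult algebra_simps)
    have "n > 0"
      using nontriv by (auto simp: n_def u1 v1 w1)
    moreover have "int p > 1"
      using prime_gt_1_nat[OF p] by simp
    ultimately have "n < int p * n"
      by simp
    then have "u1 = 0 \<and> v1 = 0 \<and> w1 = 0"
      using \<open>n > 0\<close> eq' by (intro less.hyps) (auto simp: n n_def[symmetric])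
    then show False
      using nontriv by (simp add: u1 v1 w1)
  qed
qed

section \<open>Products and divisors of principal ideals\<close>

text \<open>A product ideal consists of sums of products in general, but here the common factor
  \<open>a\<close> can be taken out of each sum, so single multiples of \<open>a\<close>
  suffice.\<close>

lemma (in cring) ideal_prod_cgenideal:
  assumes a: "a \<in> carrier R" and I: "ideal I R"
  shows "(PIdl a) \<cdot>\<^bsub>R\<^esub> I = (\<otimes>) a ` I"
proof
  interpret I: ideal I R by (rule I)
  show "(PIdl a) \<cdot>\<^bsub>R\<^esub> I \<subseteq> (\<otimes>) a ` I"
  proof
    fix x assume "x \<in> (PIdl a) \<cdot>\<^bsub>R\<^esub> I"
    then show "x \<in> (\<otimes>) a ` I"
    proof induction
      case (prod i j)
      then obtain r where r: "r \<in> carrier R" "i = r \<otimes> a"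
        by (auto simp: cgenideal_def)
      then have "i \<otimes> j = a \<otimes> (r \<otimes> j)"
        using a prod I.Icarr by (simp add: m_ac)
      then show ?case
        using r prod I.I_l_closed by blast
    next
      case (sum x y)
      then obtain i j where ij: "i \<in> I" "j \<in> I" "x = a \<otimes> i" "y = a \<otimes> j"
        by blast
      then have "x \<oplus> y = a \<otimes> (i \<oplus> j)"
        using a I.Icarr by (simp add: r_distr)
      then show ?case
        using ij I.a_closed by blast
    qed
  qed
  show "(\<otimes>) a ` I \<subseteq> (PIdl a) \<cdot>\<^bsub>R\<^esub> I"
    using cgenideal_self[OF a] by (auto intro: ideal_prod.prod)
qed

lemma (in cring) cgenideal_ideal_prod:
  assumes "a \<in> carrier R" "b \<in> carrier R"
  shows "(PIdl a) \<cdot>\<^bsub>R\<^esub> (PIdl b) = PIdl (a \<otimes> b)"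
proof -
  have "(PIdl a) \<cdot>\<^bsub>R\<^esub> (PIdl b) = (\<otimes>) a ` (PIdl b)"
    by (rule ideal_prod_cgenideal[OF assms(1) cgenideal_ideal[OF assms(2)]])
  also have "\<dots> = PIdl (a \<otimes> b)"
    using assms by (auto simp: cgenideal_def image_def m_ac)
  finally show ?thesis .
qed

text \<open>The generator \<open>c\<close> itself has the form \<open>a \<otimes> b\<close> with
  \<open>b\<close> in \<open>I\<close>. For any other \<open>x\<close> in \<open>I\<close>, the
  element \<open>a \<otimes> x\<close> is a multiple of \<open>a \<otimes> b\<close>, and cancelling
  \<open>a\<close> makes \<open>x\<close> a multiple of \<open>b\<close>.\<close>

lemma (in domain) divisor_of_cgenideal_principal:
  assumes a: "a \<in> carrier R" "a \<noteq> \<zero>" and c: "c \<in> carrier R" and I: "ideal I R"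
    and eq: "PIdl c = (PIdl a) \<cdot>\<^bsub>R\<^esub> I"
  obtains b where "b \<in> carrier R" "I = PIdl b" "c = a \<otimes> b"
proof -
  interpret I: ideal I R by (rule I)
  have prod: "PIdl c = (\<otimes>) a ` I"
    using eq ideal_prod_cgenideal[OF a(1) I] by simp
  then obtain b where b: "b \<in> I" "c = a \<otimes> b"
    using cgenideal_self[OF c] by auto
  have "x \<in> PIdl b" if x: "x \<in> I" for x
  proof -
    have "a \<otimes> x \<in> PIdl c"
      using prod x by simp
    then obtain r where r: "r \<in> carrier R" "a \<otimes> x = r \<otimes> c"
      by (auto simp: cgenideal_def)
    have "a \<otimes> x = a \<otimes> (r \<otimes> b)"
      using r b a I.Icarr by (simp add: m_lcomm)
    then have "x = r \<otimes> b"
      using a r b x I.Icarr m_lcancel by simp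
    then show ?thesis
      using r by (auto simp: cgenideal_def)
  qed
  then have "I = PIdl b"
    using cgenideal_minimal[OF I b(1)] by blast
  then show thesis
    using that b I.Icarr by blast
qed

text \<open>Suppose \<open>a = c \<otimes> b\<close>. As the ideal of \<open>a\<close> is prime, it
  contains \<open>b\<close> or \<open>c\<close>. The first makes the two ideals equal; the second
  gives \<open>c = d \<otimes> a\<close>, and cancelling \<open>a\<close> makes \<open>b\<close> a
  unit.\<close>

lemma (in domain) distinct_prime_generators:
  assumes a: "a \<in> carrier R" "a \<noteq> \<zero>" and b: "b \<in> carrier R"
    and primes: "primeideal (PIdl a) R" "primeideal (PIdl b) R" and "PIdl a \<noteq> PIdl b"
  shows "a \<notin> PIdl b"
proof
  assume "a \<in> PIdl b"
  then obtain c where c: "c \<in> carrier R" "a = c \<otimes> b"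
    by (auto simp: cgenideal_def)
  then have "c \<in> PIdl a \<or> b \<in> PIdl a"
    using primeideal.I_prime[OF primes(1) c(1) b] cgenideal_self[OF a(1)] by simp
  moreover have "b \<notin> PIdl a"
    using \<open>PIdl a \<noteq> PIdl b\<close> \<open>a \<in> PIdl b\<close> cgenideal_minimal cgenideal_ideal a b by blast
  ultimately obtain d where d: "d \<in> carrier R" "c = d \<otimes> a"
    by (auto simp: cgenideal_def)
  have "a \<otimes> \<one> = a \<otimes> (d \<otimes> b)"
    using c d a b by (metis m_assoc m_comm m_closed r_one)
  then have "\<one> = d \<otimes> b"
    using a b d m_lcancel[OF a(2,1) one_closed, of "d \<otimes> b"] by blast
  then have "\<one> \<in> PIdl b"
    using d by (auto simp: cgenideal_def)
  then show False
    using primeideal.I_notcarr[OF primes(2)] ideal.one_imp_carrier[OF cgenideal_ideal[OF b]] by simp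
qed

section \<open>A degree bound for intermediate fields\<close>

text \<open>This replaces the tower law. If \<open>x\<close> lies outside \<open>L\<close>, then
  \<open>L\<close> and its translate by \<open>x\<close> meet only in zero, so \<open>Us\<close>
  together with its multiples by \<open>x\<close> is independent over \<open>F\<close> and has more
  than \<open>n\<close> members.\<close>

lemma (in field) subfield_eq_carrier_if_independent:
  assumes F: "subfield F R" and L: "subfield L R" "F \<subseteq> L"
    and dim: "dimension n F (carrier R)"
    and Us: "independent F Us" "set Us \<subseteq> L" and n: "n < 2 * length Us"
  shows "L = carrier R"
proof (rule ccontr)
  assume "L \<noteq> carrier R"
  note Lp = subringE[OF subfieldE(1)[OF L(1)]]
  obtain x where x: "x \<in> carrier R" "x \<notin> L"
    using \<open>L \<noteq> carrier R\<close> Lp(1) by blast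
  let ?Vs = "map (\<lambda>u. u \<otimes> x) Us"
  have F_carr: "F \<subseteq> carrier R" and Us_carr: "set Us \<subseteq> carrier R" and Vs_carr: "set ?Vs \<subseteq> carrier R"
    using L(2) Lp(1) Us(2) x by auto
  have x0: "x \<noteq> \<zero>"
    using x Lp(2) by blast
  have comb: "combine Ks ?Vs = combine Ks Us \<otimes> x" if "set Ks \<subseteq> F" for Ks
    using that combine_l_distr[OF _ Us_carr x(1)] F_carr by (metis order_trans)
  have combL: "combine Ks Us \<in> L" if "set Ks \<subseteq> F" for Ks
    using that Us(2) L(2) Lp by (induction Ks Us rule: combine.induct) auto
  have "independent F ?Vs"
  proof (rule trivial_combine_imp_independent[OF F Vs_carr])
    fix Ks assume Ks: "set Ks \<subseteq> F" "combine Ks ?Vs = \<zero>"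
    then have "combine Ks Us = \<zero>"
      using comb combL[OF Ks(1)] Lp(1) x(1) x0 integral by (metis subsetD)
    then show "set (take (length ?Vs) Ks) \<subseteq> {\<zero>}"
      using independent_imp_trivial_combine[OF F Us(1)] Ks by simp
  qed
  moreover have "Span F Us \<inter> Span F ?Vs = {\<zero>}"
  proof -
    have "z = \<zero>" if z: "z \<in> Span F Us" "z \<in> Span F ?Vs" for z
    proof -
      from z obtain Ks Ls where Ks: "set Ks \<subseteq> F" "z = combine Ks Us" and Ls: "set Ls \<subseteq> F" "z = combine Ls ?Vs"
        using Span_mem_iff_length_version[OF F Us_carr] Span_mem_iff_length_version[OF F Vs_carr] by blast
      define l where "l = combine Ls Us"
      have l: "l \<in> L" "z = l \<otimes> x" "z \<in> L"
        using comb combL Ks Ls by (simp_all add: l_def)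
      \<comment> \<open>Dividing \<open>z\<close> by a nonzero \<open>l\<close> would put
        \<open>x\<close> into \<open>L\<close>.\<close>
      have "l = \<zero>"
        using subfield_m_inv_simprule[OF L(1), of l x] l x by auto
      then show ?thesis
        using l x by simp
    qed
    then show ?thesis
      using Span_subgroup_props(2)[OF F] Us_carr Vs_carr by blast
  qed
  ultimately have "independent F (Us @ ?Vs)"
    using independent_append[OF F] Us(1) by blast
  then have "length (Us @ ?Vs) \<le> n"
    using independent_length_le_dimension[OF F dim, of "Us @ ?Vs"] Us_carr Vs_carr by simp
  then show False
    using n by simp
qed

section \<open>Complex embeddings of a field, and quadratic extensions\<close>

lemma field_complex_ring: "field complex_ring"
  by (rule field_from_type_algebra)

lemma complex_ring_simps [simp]:
  "carrier complex_ring = UNIV" "x \<otimes>\<^bsub>complex_ring\<^esub> y = x * y" "x \<oplus>\<^bsub>complex_ring\<^esub> y = x + y"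
  "\<one>\<^bsub>complex_ring\<^esub> = 1" "\<zero>\<^bsub>complex_ring\<^esub> = 0"
  by (simp_all add: ring_of_type_algebra_def)

context field
begin

context
  fixes h assumes h: "h \<in> embeddings R"
begin

lemma embedding_mult: "x \<in> carrier R \<Longrightarrow> y \<in> carrier R \<Longrightarrow> h (x \<otimes> y) = h x * h y"
  and embedding_add: "x \<in> carrier R \<Longrightarrow> y \<in> carrier R \<Longrightarrow> h (x \<oplus> y) = h x + h y"
  and embedding_one: "h \<one> = 1"
  using h by (simp_all add: embeddings_def ring_hom_def)

lemma embedding_zero: "h \<zero> = 0"
  using embedding_add[of \<zero> \<zero>] by simp

lemma embedding_minus: "x \<in> carrier R \<Longrightarrow> h (\<ominus> x) = - h x"
  using embedding_add[of "\<ominus> x" x] by (simp add: l_neg embedding_zero eq_neg_iff_add_eq_0)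

lemma embedding_eq_iff:
  assumes "x \<in> carrier R" "y \<in> carrier R"
  shows "h x = h y \<longleftrightarrow> x = y"
proof -
  have "inj_on h (carrier R)"
    using non_trivial_field_hom_is_inj[OF _ field_axioms field_complex_ring] h
    by (simp add: embeddings_def)
  then show ?thesis
    using assms by (auto simp: inj_on_def)
qed

lemma embedding_eq_0_iff: "x \<in> carrier R \<Longrightarrow> h x = 0 \<longleftrightarrow> x = \<zero>"
  using embedding_eq_iff[of x \<zero>] by (simp add: embedding_zero)

lemma embedding_inv:
  assumes "x \<in> carrier R" "x \<noteq> \<zero>"
  shows "h (inv x) = inverse (h x)"
proof -
  have "x \<in> Units R"
    using assms by (simp add: field_Units)
  then have "h x * h (inv x) = 1"
    using assms embedding_mult[of x "inv x"] by (simp add: embedding_one)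
  then show ?thesis
    by (metis inverse_unique)
qed

lemma embedding_add_pow_nat: "x \<in> carrier R \<Longrightarrow> h ([(n::nat)] \<cdot> x) = of_nat n * h x"
  by (induction n) (simp_all add: embedding_zero embedding_add algebra_simps)

lemma embedding_add_pow_int: "x \<in> carrier R \<Longrightarrow> h ([(k::int)] \<cdot> x) = of_int k * h x"
  by (cases "k \<ge> 0") (simp_all add: add_pow_int_ge add_pow_int_lt embedding_add_pow_nat embedding_minus)

lemma embedding_prime_field:
  assumes "x \<in> generate_field R {}"
  shows "h x \<in> \<rat>"
  using assms
proof induction
  case (a_inv x)
  then show ?case using generate_field_in_carrier[of "{}" x] by (simp add: embedding_minus)
next
  case (m_inv x)
  then show ?case using generate_field_in_carrier[of "{}" x] by (simp add: embedding_inv)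
next
  case (eng_add x y)
  then show ?case using generate_field_in_carrier[of "{}"] by (simp add: embedding_add)
next
  case (eng_mult x y)
  then show ?case using generate_field_in_carrier[of "{}"] by (simp add: embedding_mult)
qed (simp_all add: embedding_one)

end

lemma embedding_restrict:
  assumes "h \<in> embeddings R" "subfield F R"
  shows "h \<in> embeddings (R\<lparr>carrier := F\<rparr>)"
  using assms(1) subringE(1)[OF subfieldE(1)[OF assms(2)]]
  unfolding embeddings_def ring_hom_def by (simp add: subset_iff)

text \<open>Since \<open>F\<close> is the span of 1, an element \<open>x\<close> outside
  \<open>F\<close> is independent of 1, and two independent vectors in dimension 2 span
  everything.\<close>

lemma dimension_2_decomp:
  assumes F: "subfield F R" "dimension 2 F (carrier R)" and x: "x \<in> carrier R" "x \<notin> F"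
    and z: "z \<in> carrier R"
  obtains u v where "u \<in> F" "v \<in> F" "z = u \<otimes> x \<oplus> v"
proof -
  note Fp = subringE[OF subfieldE(1)[OF F(1)]]
  have Span1: "Span F [\<one>] = F"
  proof -
    have "Span F [\<one>] = {k \<otimes> \<one> \<oplus> \<zero> | k. k \<in> F}"
      by (auto simp: line_extension_mem_iff)
    also have "\<dots> = F"
      using Fp(1) by (force simp: subset_iff)
    finally show ?thesis .
  qed
  have "independent F [x, \<one>]"
    using x Span1 by (auto intro!: li_Cons)
  then have "Span F [x, \<one>] = carrier R"
    using independent_length_eq_dimension[OF F(1,2), of "[x, \<one>]"] x by simp
  then have "z \<in> line_extension F x (Span F [\<one>])"
    using z by simp
  then show thesis
    unfolding Span1 line_extension_mem_iff using that by blast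
qed

end

section \<open>Complex conjugation on a CM-field and on its integers\<close>

lemma ring_of_integers_simps [simp]:
  "x \<otimes>\<^bsub>\<O> K\<^esub> y = x \<otimes>\<^bsub>K\<^esub> y" "x \<oplus>\<^bsub>\<O> K\<^esub> y = x \<oplus>\<^bsub>K\<^esub> y"
  "\<one>\<^bsub>\<O> K\<^esub> = \<one>\<^bsub>K\<^esub>" "\<zero>\<^bsub>\<O> K\<^esub> = \<zero>\<^bsub>K\<^esub>"
  by (simp_all add: ring_of_integers_def)

lemma cm_field_field: "cm_field K \<Longrightarrow> field K"
  by (simp add: cm_field_def number_field_def)

text \<open>The conjugate is constructed algebraically over the totally real subfield
  \<open>F\<close>: every embedding maps \<open>x\<close> to a nonreal root of a quadratic
  polynomial with real coefficients, so complex conjugation must interchange its two roots.\<close>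

lemma cm_conj_exists:
  fixes K (structure)
  assumes K: "cm_field K" and ne: "embeddings K \<noteq> {}" and z: "z \<in> carrier K"
  shows "\<exists>y\<in>carrier K. \<forall>h\<in>embeddings K. h y = cnj (h z)"
proof -
  interpret field K by (rule cm_field_field[OF K])
  obtain F where F: "subfield F K" "totally_real (K\<lparr>carrier := F\<rparr>)" "dimension 2 F (carrier K)"
    using K by (auto simp: cm_field_def)
  note Fp = subringE[OF subfieldE(1)[OF F(1)]]
  have real: "h f \<in> \<real>" if "h \<in> embeddings K" "f \<in> F" for h f
    using F(2) embedding_restrict[OF that(1) F(1)] that(2) by (auto simp: totally_real_def)
  have imag: "\<not> h ` carrier K \<subseteq> \<real>" if "h \<in> embeddings K" for h
    using K that by (simp add: cm_field_def totally_imaginary_def)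
  \<comment> \<open>If \<open>F\<close> were all of \<open>K\<close>, any embedding would have real
    image, against total imaginarity. The existence of an embedding enters here.\<close>
  obtain x where x: "x \<in> carrier K" "x \<notin> F"
    using ne real imag by blast
  note decomp = dimension_2_decomp[OF F(1,3) x]
  obtain s t where st: "s \<in> F" "t \<in> F" "x \<otimes> x = s \<otimes> x \<oplus> t"
    using decomp[of "x \<otimes> x"] x by auto
  obtain u v where uv: "u \<in> F" "v \<in> F" "z = u \<otimes> x \<oplus> v"
    using decomp z by blast
  have carr: "s \<in> carrier K" "t \<in> carrier K" "u \<in> carrier K" "v \<in> carrier K"
    using Fp(1) st uv by auto
  \<comment> \<open>\<open>s \<ominus> x\<close> is the other root of the minimal polynomial of \<open>x\<close> over \<open>F\<close>.\<close>
  define y where "y = u \<otimes> (s \<ominus> x) \<oplus> v"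
  have "h y = cnj (h z)" if h: "h \<in> embeddings K" for h
  proof -
    note hom = embedding_add[OF h] embedding_mult[OF h] embedding_minus[OF h]
    have cnjF: "cnj (h f) = h f" if "f \<in> F" for f
      using real[OF h that] by (simp add: Reals_cnj_iff)
    \<comment> \<open>If \<open>h x\<close> were real, so would be the whole image of
      \<open>K\<close>, because each element is linear in \<open>x\<close> over
      \<open>F\<close>.\<close>
    have "h x \<notin> \<real>"
    proof
      assume "h x \<in> \<real>"
      have "h w \<in> \<real>" if w: "w \<in> carrier K" for w
      proof -
        obtain c d where cd: "c \<in> F" "d \<in> F" "w = c \<otimes> x \<oplus> d"
          by (rule decomp[OF w])
        moreover from this have "c \<in> carrier K" "d \<in> carrier K"
          using Fp(1) by auto
        ultimately have "h w = h c * h x + h d"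
          using x by (simp add: hom)
        then show ?thesis
          using real[OF h] cd \<open>h x \<in> \<real>\<close> by simp
      qed
      then show False
        using imag[OF h] by blast
    qed
    then have "h x - cnj (h x) \<noteq> 0"
      by (simp add: Reals_cnj_iff)
    have sq: "h x * h x = h s * h x + h t"
      using arg_cong[OF st(3), of h] x carr by (simp add: hom)
    from arg_cong[OF sq, of cnj] have "cnj (h x) * cnj (h x) = h s * cnj (h x) + h t"
      by (simp add: cnjF st(1,2))
    \<comment> \<open>Subtracting the equations of the two conjugate roots factors out their
      difference; what remains says that their sum is \<open>h s\<close>.\<close>
    with sq have "(h x - cnj (h x)) * (h x + cnj (h x) - h s) = 0"
      by (simp add: algebra_simps)
    with \<open>h x - cnj (h x) \<noteq> 0\<close> have "h x + cnj (h x) - h s = 0"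
      by (metis mult_eq_0_iff)
    then have "cnj (h x) = h s - h x"
      by (simp add: algebra_simps)
    then show ?thesis
      using x carr uv cnjF by (simp add: y_def hom a_minus_def)
  qed
  then show ?thesis
    using x carr by (auto simp: y_def)
qed

context
  fixes K :: "('a, 'b) ring_scheme" (structure)
  assumes K: "cm_field K" and ne: "embeddings K \<noteq> {}"
begin

interpretation field K
  by (rule cm_field_field[OF K])

text \<open>The description in \<open>cm_conj_def\<close> is unique because a single embedding,
  being injective, already determines \<open>y\<close>.\<close>

lemma cm_conj:
  assumes "x \<in> carrier K"
  shows cm_conj_closed: "cm_conj K x \<in> carrier K"
    and embedding_cm_conj: "h \<in> embeddings K \<Longrightarrow> h (cm_conj K x) = cnj (h x)"
proof -
  have "\<exists>!y. y \<in> carrier K \<and> (\<forall>h\<in>embeddings K. h y = cnj (h x))"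
    using cm_conj_exists[OF K ne assms] ne embedding_eq_iff by (metis all_not_in_conv)
  from theI'[OF this]
  show "cm_conj K x \<in> carrier K" "h \<in> embeddings K \<Longrightarrow> h (cm_conj K x) = cnj (h x)"
    unfolding cm_conj_def[symmetric] by auto
qed

text \<open>Algebraic identities for the conjugation are thereby reduced to those of
  \<open>cnj\<close>.\<close>

lemma cm_conj_eqI:
  assumes "x \<in> carrier K" "y \<in> carrier K" "\<And>h. h \<in> embeddings K \<Longrightarrow> h y = cnj (h x)"
  shows "cm_conj K x = y"
  using ne assms cm_conj embedding_eq_iff by (metis all_not_in_conv)

lemma cm_conj_cm_conj: "x \<in> carrier K \<Longrightarrow> cm_conj K (cm_conj K x) = x"
  by (rule cm_conj_eqI) (simp_all add: cm_conj)

lemma cm_conj_mult: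
  "x \<in> carrier K \<Longrightarrow> y \<in> carrier K \<Longrightarrow> cm_conj K (x \<otimes> y) = cm_conj K x \<otimes> cm_conj K y"
  by (rule cm_conj_eqI) (simp_all add: cm_conj embedding_mult)

lemma cm_conj_ring_hom: "cm_conj K \<in> ring_hom K K"
proof (rule ring_hom_memI)
  show "cm_conj K \<one> = \<one>"
    by (rule cm_conj_eqI) (simp_all add: embedding_one)
  show "cm_conj K (x \<oplus> y) = cm_conj K x \<oplus> cm_conj K y" if "x \<in> carrier K" "y \<in> carrier K" for x y
    using that by (intro cm_conj_eqI) (simp_all add: cm_conj embedding_add)
qed (simp_all add: cm_conj_mult cm_conj_closed)

text \<open>Conjugation fixes the integral coefficients of a monic polynomial, so it carries roots
  to roots of the same polynomial.\<close>

lemma alg_integer_cm_conj: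
  assumes "alg_integer K x"
  shows "alg_integer K (cm_conj K x)"
proof -
  let ?Z = "range (\<lambda>k::int. [k] \<cdot> \<one>)"
  obtain f where f: "f \<in> carrier (univ_poly K ?Z)" "f \<noteq> []" "hd f = \<one>" "eval f x = \<zero>"
    and x: "x \<in> carrier K"
    using assms by (auto simp: alg_integer_def)
  have Z: "set f \<subseteq> ?Z"
    using f(1,2) by (simp add: univ_poly_carrier[symmetric] polynomial_def)
  have "map (cm_conj K) f = f"
  proof (rule map_idI)
    fix c assume "c \<in> set f"
    then obtain k :: int where "c = [k] \<cdot> \<one>"
      using Z by blast
    then show "cm_conj K c = c"
      by (intro cm_conj_eqI) (simp_all add: embedding_add_pow_int embedding_one)
  qed
  moreover have "ring_hom_ring K K (cm_conj K)"
    using cm_conj_ring_hom ring_axioms by (intro ring_hom_ringI2)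
  ultimately have "cm_conj K (eval f x) = eval f (cm_conj K x)"
    using ring_hom_ring.eval_hom'[of K K "cm_conj K" x f] x Z by auto
  then have "eval f (cm_conj K x) = \<zero>"
    using f(4) cm_conj_eqI[of \<zero> \<zero>] by (simp add: embedding_zero)
  then show ?thesis
    using f x cm_conj_closed by (auto simp: alg_integer_def)
qed

lemma cm_conj_ring_of_integers: "x \<in> carrier (\<O> K) \<Longrightarrow> cm_conj K x \<in> carrier (\<O> K)"
  by (simp add: ring_of_integers_def cm_conj_closed alg_integer_cm_conj)

text \<open>One inclusion is multiplicativity. The other is the same inclusion for the conjugate of
  \<open>a\<close>, since conjugation is an involution.\<close>

lemma cm_conj_cgenideal:
  assumes a: "a \<in> carrier (\<O> K)"
  shows "cm_conj K ` (PIdl\<^bsub>\<O> K\<^esub> a) = PIdl\<^bsub>\<O> K\<^esub> (cm_conj K a)"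
proof -
  have incl: "cm_conj K ` (PIdl\<^bsub>\<O> K\<^esub> a) \<subseteq> PIdl\<^bsub>\<O> K\<^esub> (cm_conj K a)" if "a \<in> carrier (\<O> K)" for a
  proof
    fix y assume "y \<in> cm_conj K ` (PIdl\<^bsub>\<O> K\<^esub> a)"
    then obtain r where r: "r \<in> carrier (\<O> K)" "y = cm_conj K (r \<otimes> a)"
      unfolding cgenideal_def ring_of_integers_simps by blast
    then have "y = cm_conj K r \<otimes> cm_conj K a"
      using that cm_conj_mult by (simp add: ring_of_integers_def)
    then show "y \<in> PIdl\<^bsub>\<O> K\<^esub> (cm_conj K a)"
      using cm_conj_ring_of_integers[OF r(1)] unfolding cgenideal_def ring_of_integers_simps by blast
  qed
  show ?thesis
  proof (intro equalityI incl a subsetI)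
    fix x assume x: "x \<in> PIdl\<^bsub>\<O> K\<^esub> (cm_conj K a)"
    have aK: "a \<in> carrier K"
      using a by (simp add: ring_of_integers_def)
    have "cm_conj K x \<in> PIdl\<^bsub>\<O> K\<^esub> (cm_conj K (cm_conj K a))"
      using incl[OF cm_conj_ring_of_integers[OF a]] x by blast
    then have "cm_conj K x \<in> PIdl\<^bsub>\<O> K\<^esub> a"
      by (simp only: cm_conj_cm_conj[OF aK])
    moreover have "x \<in> carrier K"
      using x cm_conj_closed[OF aK] by (auto simp: cgenideal_def ring_of_integers_def)
    ultimately show "x \<in> cm_conj K ` (PIdl\<^bsub>\<O> K\<^esub> a)"
      using cm_conj_cm_conj[of x] by (intro image_eqI[of _ _ "cm_conj K x"]) simp_all
  qed
qed

end

section \<open>From integral relations to linear independence over the rationals\<close>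

text \<open>An embedding sends the coefficients of a dependence to rational numbers; clearing
  denominators gives an integral relation for \<open>h x\<close>.\<close>

lemma (in field) independent_powers_over_prime_field:
  assumes h: "h \<in> embeddings R" and x: "x \<in> carrier R"
    and indep: "\<And>u v w :: int. of_int u * (h x)\<^sup>2 + of_int v * h x + of_int w = 0 \<Longrightarrow> u = 0 \<and> v = 0 \<and> w = 0"
  shows "independent (generate_field R {}) [\<one>, x, x \<otimes> x]"
proof (rule ccontr)
  let ?Q = "generate_field R {}"
  have Q: "subfield ?Q R"
    by (rule generate_field_is_subfield) simp
  assume "\<not> independent ?Q [\<one>, x, x \<otimes> x]"
  then obtain Ks where Ks: "length Ks = 3" "combine Ks [\<one>, x, x \<otimes> x] = \<zero>" "set Ks \<subseteq> ?Q" "set Ks \<noteq> {\<zero>}"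
    using dependent_imp_non_trivial_combine[OF Q, of "[\<one>, x, x \<otimes> x]"] x by (auto simp: numeral_3_eq_3)
  obtain c d e where cde: "Ks = [c, d, e]"
    using Ks(1) by (auto simp: length_Suc_conv numeral_3_eq_3)
  have mem: "c \<in> ?Q" "d \<in> ?Q" "e \<in> ?Q"
    using Ks(3) cde by auto
  then have carr: "c \<in> carrier R" "d \<in> carrier R" "e \<in> carrier R"
    using generate_field_in_carrier[of "{}"] by auto
  obtain c1 c2 where c: "c2 > 0" "h c = of_int c1 / of_int c2"
    using embedding_prime_field[OF h mem(1)] by (rule Rats_cases')
  obtain d1 d2 where d: "d2 > 0" "h d = of_int d1 / of_int d2"
    using embedding_prime_field[OF h mem(2)] by (rule Rats_cases')
  obtain e1 e2 where e: "e2 > 0" "h e = of_int e1 / of_int e2"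
    using embedding_prime_field[OF h mem(3)] by (rule Rats_cases')
  have "h (c \<otimes> \<one> \<oplus> (d \<otimes> x \<oplus> (e \<otimes> (x \<otimes> x) \<oplus> \<zero>))) = 0"
    using Ks(2) cde by (simp add: embedding_zero[OF h])
  then have "h c + h d * h x + h e * (h x)\<^sup>2 = 0"
    using carr x by (simp add: embedding_add[OF h] embedding_mult[OF h] power2_eq_square algebra_simps)
  then have "of_int (c2 * d2 * e2) * (h c + h d * h x + h e * (h x)\<^sup>2) = 0"
    by simp
  moreover have "of_int c1 = h c * of_int c2" "of_int d1 = h d * of_int d2" "of_int e1 = h e * of_int e2"
    using c d e by simp_all
  ultimately have "of_int (e1 * c2 * d2) * (h x)\<^sup>2 + of_int (d1 * c2 * e2) * h x + of_int (c1 * d2 * e2) = 0"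
    by (simp only: of_int_mult ring_distribs mult_ac) (simp add: add_ac)
  then have "e1 * c2 * d2 = 0 \<and> d1 * c2 * e2 = 0 \<and> c1 * d2 * e2 = 0"
    by (rule indep)
  then have "h c = 0" "h d = 0" "h e = 0"
    using c d e by auto
  then show False
    using Ks(4) carr by (simp add: cde embedding_eq_0_iff[OF h])
qed

section \<open>The Weil number and the field it generates\<close>

theorem lemma6:
  fixes K :: "('a, 'b) ring_scheme" (structure)
    and p :: nat and P1 P2 :: "'a set" and \<alpha> \<pi> :: 'a
  assumes "cm_field K" and "has_degree K 4"
    and "Factorial_Ring.prime p"
    and "primeideal P1 (\<O> K)"
    and "primeideal (cm_conj K ` P1) (\<O> K)"
    and "primeideal P2 (\<O> K)"
    and "P1 \<noteq> cm_conj K ` P1" and "P1 \<noteq> P2" and "cm_conj K ` P1 \<noteq> P2"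
    and "PIdl\<^bsub>\<O> K\<^esub> ([p] \<cdot> \<one>) = P1 \<cdot>\<^bsub>\<O> K\<^esub> (cm_conj K ` P1) \<cdot>\<^bsub>\<O> K\<^esub> P2"
    and "\<alpha> \<in> carrier (\<O> K)" and "P1 = PIdl\<^bsub>\<O> K\<^esub> \<alpha>"
    and "\<pi> = \<alpha> \<otimes> inv (cm_conj K \<alpha>) \<otimes> ([p] \<cdot> \<one>)"
  shows "weil_number K (p\<^sup>2) \<pi>
    \<and> generate_field K {\<pi>} = carrier K
    \<and> cm_field (adjoin K \<pi>) \<and> has_degree (adjoin K \<pi>) 4
    \<and> PIdl\<^bsub>\<O> K\<^esub> ([p] \<cdot> \<one>) = P1 \<cdot>\<^bsub>\<O> K\<^esub> (cm_conj K ` P1) \<cdot>\<^bsub>\<O> K\<^esub> P2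
    \<and> PIdl\<^bsub>\<O> K\<^esub> \<pi> = P1 \<cdot>\<^bsub>\<O> K\<^esub> P1 \<cdot>\<^bsub>\<O> K\<^esub> P2"
proof -
  note K = assms(1) and p = assms(3) and prime1 = assms(4) and prime1' = assms(5) and prime2 = assms(6)
  interpret field K by (rule cm_field_field[OF K])
  \<comment> \<open>The ring axioms for the integers are read off from \<open>prime1\<close>: being
    a prime ideal includes that the ambient structure is a commutative ring.\<close>
  interpret O: cring "\<O> K"
    using prime1 by (simp add: primeideal_def)
  have O_K: "x \<in> carrier K" if "x \<in> carrier (\<O> K)" for x
    using that by (simp add: ring_of_integers_def)
  interpret O: domain "\<O> K"
    by unfold_locales (use O_K integral in \<open>auto simp: ring_of_integers_simps\<close>)
  let ?O = "\<O> K" and ?p = "[p] \<cdot> \<one>" and ?\<alpha>' = "cm_conj K \<alpha>"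
  have p0: "?p \<noteq> \<zero>"
    using K p by (auto simp: cm_field_def number_field_def prime_gt_0_nat)
  have p_O: "[(n::nat)] \<cdot> \<one> \<in> carrier ?O" for n
    using O.zero_closed O.one_closed O.add.m_closed by (induction n) simp_all
  have \<alpha>: "\<alpha> \<in> carrier ?O" "\<alpha> \<in> carrier K"
    using assms(11) O_K by auto
  have prod: "PIdl\<^bsub>?O\<^esub> ?p = P1 \<cdot>\<^bsub>?O\<^esub> (cm_conj K ` P1) \<cdot>\<^bsub>?O\<^esub> P2"
    by (rule assms(10))
  have I2: "ideal P2 ?O"
    using prime2 by (simp add: primeideal_def)
  have p_mem: "?p \<in> PIdl\<^bsub>?O\<^esub> ?p"
    using O.cgenideal_self p_O by blast
  have P1_\<alpha>: "P1 = PIdl\<^bsub>?O\<^esub> \<alpha>"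
    by (rule assms(12))

  \<comment> \<open>Without complex embeddings, \<open>cm_conj K\<close> would be constant, its image of \<open>P1\<close> the zero ideal, and \<open>p\<close> zero.\<close>
  have ne: "embeddings K \<noteq> {}"
  proof
    assume "embeddings K = {}"
    then obtain c where const: "\<And>x. cm_conj K x = c"
      by (simp add: cm_conj_def)
    interpret P1': ideal "cm_conj K ` P1" ?O
      using prime1' by (simp add: primeideal_def)
    have "\<zero> \<in> cm_conj K ` P1"
      using P1'.zero_closed by simp
    with const have "cm_conj K ` P1 = {\<zero>}"
      by auto
    also have "\<dots> = PIdl\<^bsub>?O\<^esub> \<zero>"
      using O.zero_closed O_K by (auto simp: cgenideal_def intro!: exI[of _ \<zero>])
    finally have "PIdl\<^bsub>?O\<^esub> ?p = (PIdl\<^bsub>?O\<^esub> (\<alpha> \<otimes>\<^bsub>?O\<^esub> \<zero>)) \<cdot>\<^bsub>?O\<^esub> P2"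
      using prod P1_\<alpha> O.cgenideal_ideal_prod[of \<alpha> \<zero>] \<alpha>(1) O.zero_closed by simp
    also have "\<dots> = (\<otimes>\<^bsub>?O\<^esub>) (\<alpha> \<otimes>\<^bsub>?O\<^esub> \<zero>) ` P2"
      by (rule O.ideal_prod_cgenideal[OF _ I2]) (use \<alpha> O.zero_closed in simp)
    finally obtain y where "y \<in> P2" "?p = \<zero> \<otimes> y"
      using p_mem \<alpha> by auto
    then show False
      using p0 ideal.Icarr[OF I2] O_K by simp
  qed
  then obtain h where h: "h \<in> embeddings K"
    by blast
  note hom = embedding_add[OF h] embedding_mult[OF h] embedding_zero[OF h] embedding_one[OF h]
    and h_inj = embedding_eq_iff[OF h]

  have \<alpha>': "?\<alpha>' \<in> carrier ?O" "?\<alpha>' \<in> carrier K"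
    using cm_conj_ring_of_integers[OF K ne \<alpha>(1)] O_K by auto
  have P1'_\<alpha>': "cm_conj K ` P1 = PIdl\<^bsub>?O\<^esub> ?\<alpha>'"
    using cm_conj_cgenideal[OF K ne \<alpha>(1)] P1_\<alpha> by simp
  have P1P1': "P1 \<cdot>\<^bsub>?O\<^esub> (cm_conj K ` P1) = PIdl\<^bsub>?O\<^esub> (\<alpha> \<otimes> ?\<alpha>')"
    using O.cgenideal_ideal_prod[OF \<alpha>(1) \<alpha>'(1)] by (simp add: P1_\<alpha>[symmetric] P1'_\<alpha>'[symmetric])
  have \<alpha>\<alpha>': "\<alpha> \<otimes> ?\<alpha>' \<in> carrier ?O"
    using O.m_closed[OF \<alpha>(1) \<alpha>'(1)] by simp
  \<comment> \<open>The element \<open>?p\<close> is a multiple of this product and is nonzero in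
    characteristic zero.\<close>
  have "\<alpha> \<otimes> ?\<alpha>' \<noteq> \<zero>"
  proof
    assume zero: "\<alpha> \<otimes> ?\<alpha>' = \<zero>"
    have "?p \<in> (\<otimes>\<^bsub>?O\<^esub>) (\<alpha> \<otimes> ?\<alpha>') ` P2"
      using p_mem prod O.ideal_prod_cgenideal[OF \<alpha>\<alpha>' I2] by (simp only: P1P1')
    then show False
      using p0 zero ideal.Icarr[OF I2] O_K by auto
  qed
  then obtain \<beta> where \<beta>: "\<beta> \<in> carrier ?O" "P2 = PIdl\<^bsub>?O\<^esub> \<beta>" "?p = \<alpha> \<otimes> ?\<alpha>' \<otimes> \<beta>"
    using O.divisor_of_cgenideal_principal[OF \<alpha>\<alpha>' _ p_O I2] prod P1P1' by auto
  have \<beta>K: "\<beta> \<in> carrier K"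
    using \<beta> O_K by simp
  have nz: "\<alpha> \<noteq> \<zero>" "?\<alpha>' \<noteq> \<zero>"
    using \<open>\<alpha> \<otimes> ?\<alpha>' \<noteq> \<zero>\<close> \<alpha>(2) \<alpha>'(2) by auto
  have inv: "inv ?\<alpha>' \<in> carrier K"
    using nz \<alpha>'(2) field_Units by simp

  have \<pi>: "\<pi> = \<alpha> \<otimes> \<alpha> \<otimes> \<beta>"
  proof -
    have "h ?\<alpha>' \<noteq> 0"
      using nz \<alpha>' by (simp add: embedding_eq_0_iff[OF h])
    \<comment> \<open>The cancellation is carried out in the complex numbers and pulled back along
      the injective \<open>h\<close>.\<close>
    then have "h (\<alpha> \<otimes> inv ?\<alpha>' \<otimes> (\<alpha> \<otimes> ?\<alpha>' \<otimes> \<beta>)) = h (\<alpha> \<otimes> \<alpha> \<otimes> \<beta>)"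
      using nz \<alpha>(2) \<alpha>'(2) \<beta>K inv by (simp add: hom embedding_inv[OF h] field_simps)
    then show ?thesis
      using nz \<alpha>(2) \<alpha>'(2) \<beta>K inv by (simp add: h_inj assms(13) \<beta>(3))
  qed
  have \<pi>K: "\<pi> \<in> carrier K" "\<pi> \<in> carrier ?O"
    using \<alpha> \<beta>(1) \<beta>K O.m_closed[OF O.m_closed[OF \<alpha>(1) \<alpha>(1)] \<beta>(1)] by (simp_all add: \<pi>)
  have \<alpha>\<alpha>: "\<alpha> \<otimes> \<alpha> \<in> carrier ?O"
    using O.m_closed[OF \<alpha>(1) \<alpha>(1)] by simp
  have PIdl_\<pi>: "PIdl\<^bsub>?O\<^esub> \<pi> = P1 \<cdot>\<^bsub>?O\<^esub> P1 \<cdot>\<^bsub>?O\<^esub> P2"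
    using O.cgenideal_ideal_prod[OF \<alpha>(1) \<alpha>(1)] O.cgenideal_ideal_prod[OF \<alpha>\<alpha> \<beta>(1)]
    by (simp add: P1_\<alpha>[symmetric] \<beta>(2)[symmetric] \<pi>)

  \<comment> \<open>The descent takes place in the image of the integers under \<open>h\<close>, a
    subring of the complex numbers. Divisibility there corresponds to membership in principal ideals
    of \<open>?O\<close>, so primality and distinctness of the ideals carry over.\<close>
  let ?S = "h ` carrier ?O"
  have dvd_iff: "(\<exists>z\<in>?S. h y = z * h x) \<longleftrightarrow> y \<in> PIdl\<^bsub>?O\<^esub> x"
    if "x \<in> carrier ?O" "y \<in> carrier ?O" for x y
    using that O_K by (auto simp: cgenideal_def hom(2)[symmetric] h_inj)
  have prime_dvd: "(\<exists>z\<in>?S. u = z * h x) \<or> (\<exists>z\<in>?S. v = z * h x)"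
    if x: "x \<in> carrier ?O" "primeideal (PIdl\<^bsub>?O\<^esub> x) ?O" and uv: "u \<in> ?S" "v \<in> ?S" "\<exists>z\<in>?S. u * v = z * h x"
    for x u v
  proof -
    obtain u' v' where u': "u' \<in> carrier ?O" "u = h u'" and v': "v' \<in> carrier ?O" "v = h v'"
      using uv by blast
    have "u' \<otimes>\<^bsub>?O\<^esub> v' \<in> PIdl\<^bsub>?O\<^esub> x"
      using uv(3) u' v' O_K O.m_closed[OF u'(1) v'(1)] dvd_iff[OF x(1), of "u' \<otimes> v'"] by (simp add: hom)
    then show ?thesis
      using primeideal.I_prime[OF x(2) u'(1) v'(1)] dvd_iff[OF x(1)] u' v' by blast
  qed
  have not_dvd_1: "\<not> (\<exists>z\<in>?S. 1 = z * h x)" if x: "x \<in> carrier ?O" "primeideal (PIdl\<^bsub>?O\<^esub> x) ?O" for x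
  proof
    assume "\<exists>z\<in>?S. 1 = z * h x"
    then have "\<one>\<^bsub>?O\<^esub> \<in> PIdl\<^bsub>?O\<^esub> x"
      using dvd_iff[OF x(1) O.one_closed] by (simp add: hom)
    then show False
      using ideal.one_imp_carrier[OF O.cgenideal_ideal[OF x(1)]] primeideal.I_notcarr[OF x(2)] by simp
  qed
  have S_add: "x + y \<in> ?S" and S_mult: "x * y \<in> ?S" if "x \<in> ?S" "y \<in> ?S" for x y
  proof -
    from that(1) obtain x' where x': "x = h x'" "x' \<in> carrier ?O"
      by (rule imageE)
    from that(2) obtain y' where y': "y = h y'" "y' \<in> carrier ?O"
      by (rule imageE)
    then have "x + y = h (x' \<oplus>\<^bsub>?O\<^esub> y')" "x * y = h (x' \<otimes>\<^bsub>?O\<^esub> y')"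
      using x' y' O_K by (simp_all add: hom)
    then show "x + y \<in> ?S" "x * y \<in> ?S"
      using O.add.m_closed[OF x'(2) y'(2)] O.m_closed[OF x'(2) y'(2)] by (simp_all only: imageI)
  qed
  have S_int: "of_int k \<in> ?S" for k
  proof -
    have nat: "of_nat n \<in> ?S" for n
      by (rule image_eqI[OF _ p_O[of n]]) (simp add: embedding_add_pow_nat[OF h] hom)
    \<comment> \<open>The negative of 1 is taken inside \<open>?O\<close>. The equation
      \<open>m \<oplus> \<one> = \<zero>\<close> determines \<open>h m\<close>, without comparing
      the negation of \<open>?O\<close> with that of \<open>K\<close>.\<close>
    obtain m where m: "m \<in> carrier ?O" "m \<oplus> \<one> = \<zero>"
      using O.l_neg[OF O.one_closed] O.a_inv_closed[OF O.one_closed] by auto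
    then have "h m + 1 = 0"
      using hom(1)[of m \<one>] O_K by (simp add: hom)
    then have "-1 = h m"
      by (metis add_eq_0_iff2)
    then have "-1 \<in> ?S"
      using m(1) by (rule image_eqI)
    from S_mult[OF this nat] have "- of_nat n \<in> ?S" for n
      by (simp only: mult_minus1)
    then show ?thesis
      using nat by (cases k rule: int_cases2) simp_all
  qed
  have "of_nat p = h ?p"
    by (simp add: embedding_add_pow_nat[OF h] hom)
  then have p_eq: "of_nat p = h \<alpha> * h ?\<alpha>' * h \<beta>"
    using \<alpha>(2) \<alpha>'(2) \<beta>K by (simp add: \<beta>(3) hom)
  have primes: "primeideal (PIdl\<^bsub>?O\<^esub> \<alpha>) ?O" "primeideal (PIdl\<^bsub>?O\<^esub> ?\<alpha>') ?O" "primeideal (PIdl\<^bsub>?O\<^esub> \<beta>) ?O"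
    using prime1 prime1' prime2 by (simp_all only: P1_\<alpha>[symmetric] P1'_\<alpha>'[symmetric] \<beta>(2)[symmetric])
  have distinct: "PIdl\<^bsub>?O\<^esub> \<alpha> \<noteq> PIdl\<^bsub>?O\<^esub> ?\<alpha>'"
    using assms(7) by (simp only: P1_\<alpha>[symmetric] P1'_\<alpha>'[symmetric] not_False_eq_True)
  have h\<pi>: "h \<pi> = (h \<alpha>)\<^sup>2 * h \<beta>"
    using \<alpha> \<beta>K by (simp add: \<pi> hom power2_eq_square)
  have "u = 0 \<and> v = 0 \<and> w = 0" if "of_int u * (h \<pi>)\<^sup>2 + of_int v * h \<pi> + of_int w = 0" for u v w
  proof (rule integral_quadratic_relation_trivial
      [where S = ?S and a = "h \<alpha>" and a' = "h ?\<alpha>'" and b = "h \<beta>" and p = p])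
    show "\<not> (\<exists>z\<in>?S. h ?\<alpha>' = z * h \<alpha>)"
      using dvd_iff[OF \<alpha>(1) \<alpha>'(1)] O.distinct_prime_generators[OF \<alpha>'(1) _ \<alpha>(1) primes(2,1)] nz distinct
      by simp
    show "\<not> (\<exists>z\<in>?S. h \<alpha> = z * h ?\<alpha>')"
      using dvd_iff[OF \<alpha>'(1) \<alpha>(1)] O.distinct_prime_generators[OF \<alpha>(1) _ \<alpha>'(1) primes(1,2)] nz distinct
      by simp
    show "h \<alpha> \<in> ?S" "h ?\<alpha>' \<in> ?S" "h \<beta> \<in> ?S"
      using \<alpha>(1) \<alpha>'(1) \<beta>(1) by (simp_all only: imageI)
    show "of_int u * ((h \<alpha>)\<^sup>2 * h \<beta>)\<^sup>2 + of_int v * ((h \<alpha>)\<^sup>2 * h \<beta>) + of_int w = 0"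
      using that by (simp only: h\<pi>)
  qed (fact p p_eq S_int not_dvd_1[OF \<alpha>(1) primes(1)] not_dvd_1[OF \<alpha>'(1) primes(2)] not_dvd_1[OF \<beta>(1) primes(3)]
      | rule S_add S_mult prime_dvd[OF \<alpha>(1) primes(1)] prime_dvd[OF \<alpha>'(1) primes(2)], assumption+)+
  then have indep: "independent (generate_field K {}) [\<one>, \<pi>, \<pi> \<otimes> \<pi>]"
    by (rule independent_powers_over_prime_field[OF h \<pi>K(1)])

  let ?L = "generate_field K {\<pi>}"
  have Q: "subfield (generate_field K {}) K" and L: "subfield ?L K"
    using \<pi>K(1) by (auto intro!: generate_field_is_subfield)
  \<comment> \<open>Three independent elements in \<open>?L\<close> are enough, since 4 is less than
    twice 3.\<close>
  have L_eq: "?L = carrier K"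
  proof (rule subfield_eq_carrier_if_independent[OF Q L _ _ indep])
    show "generate_field K {} \<subseteq> ?L"
      using generate_field_min_subfield1[OF _ L] by simp
    show "dimension 4 (generate_field K {}) (carrier K)"
      using assms(2) by (simp add: has_degree_def)
    show "set [\<one>, \<pi>, \<pi> \<otimes> \<pi>] \<subseteq> ?L"
      by (auto intro: generate_field.intros)
  qed simp
  \<comment> \<open>This is equality of records, so the embeddings, the CM property and the degree
    of the field generated by \<open>\<pi>\<close> are literally those of \<open>K\<close>.\<close>
  then have adjoin: "adjoin K \<pi> = K"
    by simp

  have "(cmod (k \<pi>))\<^sup>2 = real (p\<^sup>2)" if k: "k \<in> embeddings K" for k
  proof -
    \<comment> \<open>The quotient of \<open>k \<alpha>\<close> by its complex conjugate has
      absolute value 1, which leaves only the factor \<open>p\<close>.\<close>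
    have "k \<pi> = k \<alpha> * inverse (cnj (k \<alpha>)) * of_nat p"
      using \<alpha>(2) \<alpha>'(2) nz inv
      by (simp add: assms(13) embedding_mult[OF k] embedding_inv[OF k] embedding_one[OF k]
          embedding_add_pow_nat[OF k] embedding_cm_conj[OF K ne _ k])
    moreover have "k \<alpha> \<noteq> 0"
      using \<alpha>(2) nz by (simp add: embedding_eq_0_iff[OF k])
    ultimately show ?thesis
      by (simp add: norm_mult norm_inverse)
  qed
  then have "weil_number K (p\<^sup>2) \<pi>"
    using \<pi>K(2) by (simp add: weil_number_def adjoin ring_of_integers_def)
  then show ?thesis
    using L_eq K assms(2) prod PIdl_\<pi> by (simp add: adjoin)
qed

end
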